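(* For every $M\in\mathbb N$, the probability that $\frac{a}{M}$, with $a\in\mathbb Z$ and $\gcd(a,M)=1$, has finite order equals $1$; that is, $$\sum_{n=0}^{\infty}\frac{A(n,M)}{\varphi(M^{n+1})}=1.$$
   Context: Let $\chi:\mathbb Q\to\mathbb Q$ be defined by $\chi(x)=x\lceil x\rceil$, where $\lceil x\rceil$ is the smallest integer greater than or equal to $x$. For $x\in\mathbb Q$, $\mathrm{ord}(x)=\min\{k\in\mathbb N_0:\chi^k(x)\in\mathbb Z\}$ if this set is nonempty, and $\mathrm{ord}(x)=\infty$ otherwise ($\mathbb N=\{1,2,\dots\}$, $\mathbb N_0=\mathbb N\cup\{0\}$). For $n\in\mathbb N_0$ and $M\in\mathbb N$, let $\mathcal A_{n,M}=\{a\in\mathbb Z:\gcd(a,M)=1,\ \mathrm{ord}(a/M)=n\}$; this set is a union of congruence classes modulo $M^{n+1}$, and $A(n,M)$ denotes the number of congruence classes modulo $M^{n+1}$ contained in $\mathcal A_{n,M}$. Thus $A(n,M)/\varphi(M^{n+1})$ is the proportion of residue classes modulo $M^{n+1}$ coprime to $M$ whose elements $a$ satisfy $\mathrm{ord}(a/M)=n$, interpreted as the probability that $a/M$ (with $\gcd(a,M)=1$) has order $n$. $\varphi$ is Euler's totient function. *)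

theory Defs
  imports Complex_Main "HOL-Library.Extended_Nat" "HOL-Number_Theory.Number_Theory"
begin

definition chi :: "rat \<Rightarrow> rat" where
  "chi x = x * of_int \<lceil>x\<rceil>"

definition chi_ord :: "rat \<Rightarrow> enat" where
  "chi_ord x = (if \<exists>k. (chi ^^ k) x \<in> \<int> then enat (LEAST k. (chi ^^ k) x \<in> \<int>) else \<infinity>)"

definition ord_set :: "nat \<Rightarrow> nat \<Rightarrow> int set" where
  "ord_set n M = {a. coprime a (int M) \<and> chi_ord (of_int a / of_nat M) = enat n}"

definition cong_class :: "nat \<Rightarrow> int \<Rightarrow> int set" where
  "cong_class m r = {b. [b = r] (mod int m)}"

definition class_count :: "nat \<Rightarrow> nat \<Rightarrow> nat" where
  "class_count n M = card {C \<in> range (cong_class (M ^ (n + 1))). C \<subseteq> ord_set n M}"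

end

theory Submission
  imports Defs
begin

text \<open>Write \<open>-a = q M + s\<close> with \<open>0 \<le> s < M\<close>, and let \<open>q = g e\<close>, \<open>M = g d\<close> with
  \<open>g = gcd(q, M)\<close>. Then \<open>\<chi>(a/M) = e (g e M + s) / d\<close>. For fixed \<open>d\<close> and \<open>s\<close> coprime to \<open>M\<close>
  the map \<open>e \<mapsto> e (g e M + s)\<close> permutes the residues modulo every power of \<open>d\<close>, so the new
  numerator is again uniformly distributed. The denominators thus form a Markov chain on the
  divisors of \<open>M\<close> that moves from \<open>M\<close> to \<open>d\<close> with probability \<open>\<phi>(d)/M\<close>. Since \<open>\<phi>(M)/M < 1\<close>
  for \<open>M > 1\<close>, it is absorbed at \<open>1\<close> almost surely.\<close>

section \<open>Counting residues\<close>

definition residue_count :: "nat \<Rightarrow> int set \<Rightarrow> nat" where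
  "residue_count m S = card {x. x < m \<and> int x \<in> S}"

definition periodic :: "nat \<Rightarrow> int set \<Rightarrow> bool" where
  "periodic m S \<longleftrightarrow> (\<forall>a b. [a = b] (mod int m) \<longrightarrow> (a \<in> S \<longleftrightarrow> b \<in> S))"

lemma periodicD: "periodic m S \<Longrightarrow> [a = b] (mod int m) \<Longrightarrow> a \<in> S \<longleftrightarrow> b \<in> S"
  by (simp add: periodic_def)

lemma periodic_vimage:
  assumes "periodic m S" "\<And>a b. [a = b] (mod int m) \<Longrightarrow> [f a = f b] (mod int m)"
  shows "periodic m (f -` S)"
  using assms by (simp add: periodic_def)

lemma residue_count_empty [simp]: "residue_count m {} = 0"
  by (simp add: residue_count_def)

lemma residue_count_eq_sum: "residue_count m S = (\<Sum>x<m. of_bool (int x \<in> S))"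
  by (simp add: residue_count_def Collect_conj_eq lessThan_def)

lemma residue_count_coprime: "residue_count M {s. coprime s (int M)} = totient M"
proof (cases "M > 1")
  case True
  then have "{s. s < M \<and> coprime s M} = totatives M"
    by (auto simp: in_totatives_iff totatives_less intro!: gr0I)
  then show ?thesis by (simp add: residue_count_def totient_def)
next
  case False
  then have "M = 0 \<or> M = 1" by linarith
  then show ?thesis by (auto simp: residue_count_def)
qed

lemma card_cong_classes_subset:
  assumes "periodic m S" "m > 0"
  shows "card {C \<in> range (cong_class m). C \<subseteq> S} = residue_count m S"
proof -
  have class_eq: "cong_class m x = cong_class m y \<longleftrightarrow> [x = y] (mod int m)" for x y
    unfolding cong_class_def by (auto simp: cong_def)
  have class_subset: "cong_class m x \<subseteq> S \<longleftrightarrow> x \<in> S" for x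
    using periodicD[OF assms(1)] unfolding cong_class_def by (auto simp: cong_sym_eq)
  let ?R = "{x. x < m \<and> int x \<in> S}"
  have "bij_betw (cong_class m \<circ> int) ?R {C \<in> range (cong_class m). C \<subseteq> S}"
  proof (intro bij_betw_imageI inj_onI equalityI subsetI)
    fix x y assume "x \<in> ?R" "y \<in> ?R" "(cong_class m \<circ> int) x = (cong_class m \<circ> int) y"
    then show "x = y" by (simp add: class_eq cong_int_iff cong_less_modulus_unique_nat)
  next
    fix C assume "C \<in> {C \<in> range (cong_class m). C \<subseteq> S}"
    then obtain x where C: "C = cong_class m x" and x: "x \<in> S" using class_subset by auto
    define y where "y = nat (x mod int m)"
    have y: "int y = x mod int m" "y < m" using assms(2) by (simp_all add: y_def nat_less_iff)
    then have "[x = int y] (mod int m)" by (simp add: cong_def)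
    then have "C = cong_class m (int y)" "int y \<in> S"
      using C x class_eq periodicD[OF assms(1)] by blast+
    then show "C \<in> (cong_class m \<circ> int) ` ?R" using y(2) by auto
  qed (use class_subset in auto)
  then show ?thesis unfolding residue_count_def by (rule bij_betw_same_card[symmetric])
qed

lemma residue_count_vimage:
  assumes "periodic m S"
    and f_cong_iff: "\<And>a b. [f a = f b] (mod int m) \<longleftrightarrow> [a = b] (mod int m)"
  shows "residue_count m (f -` S) = residue_count m S"
proof (cases "m = 0")
  case False
  define h where "h x = nat (f (int x) mod int m)" for x
  have h_less: "h x < m" and h_cong: "[int (h x) = f (int x)] (mod int m)" for x
    using False by (simp_all add: h_def nat_less_iff)
  have "inj_on h {..<m}"
  proof (rule inj_onI)
    fix x y assume xy: "x \<in> {..<m}" "y \<in> {..<m}" "h x = h y"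
    have "[f (int x) = f (int y)] (mod int m)"
      using h_cong[of x] h_cong[of y] unfolding xy(3) by (blast intro: cong_sym cong_trans)
    then show "x = y" using xy f_cong_iff by (simp add: cong_int_iff cong_less_modulus_unique_nat)
  qed
  then have "bij_betw h {..<m} {..<m}"
    using h_less by (intro bij_betw_imageI endo_inj_surj) auto
  then have "(\<Sum>x<m. of_bool (int (h x) \<in> S)) = (\<Sum>x<m. of_bool (int x \<in> S))"
    by (rule sum.reindex_bij_betw)
  then show ?thesis
    using periodicD[OF assms(1) h_cong] by (simp only: residue_count_eq_sum vimage_eq)
qed (simp add: residue_count_def)

lemma residue_count_split_mod:
  "residue_count (m * k) S = (\<Sum>s<k. residue_count m {q. q * int k + int s \<in> S})"
proof -
  have "residue_count (m * k) S = (\<Sum>q<m. \<Sum>b = q * k..<q * k + k. of_bool (int b \<in> S))"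
    by (simp only: residue_count_eq_sum sum.nat_group)
  also have "\<dots> = (\<Sum>q<m. \<Sum>s<k. of_bool (int q * int k + int s \<in> S))"
    by (simp add: sum.atLeastLessThan_shift_0[of _ "_ * k"] atLeast0LessThan del: sum_of_bool_eq)
  also have "\<dots> = (\<Sum>s<k. \<Sum>q<m. of_bool (int q * int k + int s \<in> S))"
    by (rule sum.swap)
  finally show ?thesis by (simp only: residue_count_eq_sum mem_Collect_eq)
qed

lemma residue_count_mult:
  assumes "periodic m S"
  shows "residue_count (t * m) S = t * residue_count m S"
proof -
  have "q * int m + int s \<in> S \<longleftrightarrow> int s \<in> S" for q s
    by (intro periodicD[OF assms]) (simp add: cong_def)
  then have "residue_count t {q. q * int m + int s \<in> S} = t * of_bool (int s \<in> S)" for s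
    by (cases "int s \<in> S") (simp_all add: residue_count_def)
  then have "residue_count (t * m) S = (\<Sum>s<m. t * of_bool (int s \<in> S))"
    by (simp only: residue_count_split_mod)
  then show ?thesis by (simp only: residue_count_eq_sum sum_distrib_left)
qed

lemma residue_count_gcd_eq:
  assumes "g > 0"
  shows "residue_count (g * d * k) {q \<in> S. gcd q (int (g * d)) = int g} =
    residue_count (d * k) {e. coprime e (int d) \<and> int g * e \<in> S}"
proof -
  let ?E = "{e. e < d * k \<and> coprime e d \<and> int (g * e) \<in> S}"
  have gcd_mult: "gcd (g * e) (g * d) = g \<longleftrightarrow> coprime e d" for e
    unfolding gcd_mult_distrib_nat[symmetric] coprime_iff_gcd_eq_1 using assms by simp
  have "{q. q < g * d * k \<and> int q \<in> S \<and> gcd q (g * d) = g} = (*) g ` ?E"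
  proof (intro equalityI subsetI)
    fix q assume q: "q \<in> {q. q < g * d * k \<and> int q \<in> S \<and> gcd q (g * d) = g}"
    then have "gcd q (g * d) = g" by simp
    then have "g dvd q" by (metis gcd_dvd1)
    then obtain e where e: "q = g * e" by (elim dvdE)
    then have "e \<in> ?E" using q assms gcd_mult by simp
    then show "q \<in> (*) g ` ?E" using e by blast
  next
    fix q assume "q \<in> (*) g ` ?E"
    then obtain e where "q = g * e" "e < d * k" "coprime e d" "int q \<in> S" by auto
    then show "q \<in> {q. q < g * d * k \<and> int q \<in> S \<and> gcd q (g * d) = g}"
      using assms gcd_mult by simp
  qed
  moreover have "inj_on ((*) g) ?E" using assms by (simp add: inj_on_def)
  moreover have "gcd (int q) (int g * int d) = int g \<longleftrightarrow> gcd q (g * d) = g" for q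
    by (simp only: gcd_int_int_eq of_nat_eq_iff flip: of_nat_mult)
  ultimately show ?thesis by (simp add: residue_count_def card_image)
qed

lemma residue_count_split_gcd:
  assumes "M > 0"
  shows "residue_count (M * k) S =
    (\<Sum>d | d dvd M. residue_count (d * k) {e. coprime e (int d) \<and> int (M div d) * e \<in> S})"
proof -
  define Q where "Q = {q. q < M * k \<and> int q \<in> S}"
  have "finite Q" "(\<lambda>q. gcd q M) ` Q \<subseteq> {g. g dvd M}" by (auto simp: Q_def)
  then have "card Q = (\<Sum>g | g dvd M. card {q \<in> Q. gcd q M = g})"
    using assms sum.group[of Q "{g. g dvd M}" "\<lambda>q. gcd q M" "\<lambda>_. 1 :: nat"] by simp
  also have "\<dots> = (\<Sum>d | d dvd M. card {q \<in> Q. gcd q M = M div d})"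
    using assms by (intro sum.reindex_bij_witness[of _ "(div) M" "(div) M"]) (auto elim: dvdE)
  also have "\<dots> = (\<Sum>d | d dvd M.
      residue_count (d * k) {e. coprime e (int d) \<and> int (M div d) * e \<in> S})"
  proof (intro sum.cong refl)
    fix d assume "d \<in> {d. d dvd M}"
    then have M: "M div d * d = M" by simp
    then have "M div d > 0" using assms by (metis gr0I mult_0 less_irrefl)
    then show "card {q \<in> Q. gcd q M = M div d} =
        residue_count (d * k) {e. coprime e (int d) \<and> int (M div d) * e \<in> S}"
      using residue_count_gcd_eq[of "M div d" d k S] unfolding M
      by (simp add: residue_count_def Q_def)
  qed
  finally show ?thesis by (simp only: Q_def residue_count_def[of "M * k" S])
qed

section \<open>One step of the iteration\<close>

lemma chi_ord_rec: "chi_ord x = (if x \<in> \<int> then 0 else eSuc (chi_ord (chi x)))"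
proof (cases "x \<in> \<int>")
  case True
  then have "\<exists>k. (chi ^^ k) x \<in> \<int>" by (intro exI[of _ 0]) simp
  moreover have "(LEAST k. (chi ^^ k) x \<in> \<int>) = 0" using True by (intro Least_eq_0) simp
  ultimately show ?thesis using True by (simp add: chi_ord_def zero_enat_def)
next
  case False
  have shift: "(chi ^^ Suc k) x = (chi ^^ k) (chi x)" for k
    by (simp only: funpow_Suc_right o_apply)
  have Ints_iff: "(\<exists>k. (chi ^^ k) x \<in> \<int>) \<longleftrightarrow> (\<exists>k. (chi ^^ k) (chi x) \<in> \<int>)"
    using False shift by (metis funpow_0 not0_implies_Suc)
  have "(LEAST k. (chi ^^ k) x \<in> \<int>) = Suc (LEAST k. (chi ^^ k) (chi x) \<in> \<int>)"
    if "(chi ^^ k) (chi x) \<in> \<int>" for k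
    using Least_Suc[of "\<lambda>k. (chi ^^ k) x \<in> \<int>" "Suc k"] that False unfolding shift by simp
  then show ?thesis using False Ints_iff by (auto simp: chi_ord_def eSuc_enat)
qed

lemma chi_ord_eq_0_iff: "chi_ord x = enat 0 \<longleftrightarrow> x \<in> \<int>"
  by (subst chi_ord_rec) (simp add: zero_enat_def[symmetric])

lemma chi_ord_eq_Suc_iff: "chi_ord x = enat (Suc n) \<longleftrightarrow> x \<notin> \<int> \<and> chi_ord (chi x) = enat n"
  by (subst chi_ord_rec) (simp add: eSuc_enat[symmetric] zero_enat_def[symmetric])

lemma chi_add_of_int: "chi (x + of_int k) = chi x + of_int k * (x + of_int (\<lceil>x\<rceil> + k))"
  by (simp add: chi_def algebra_simps)

lemma chi_ord_add_of_int_eq_enat_iff: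
  assumes "of_nat M * x \<in> \<int>"
  shows "chi_ord (x + of_int (int M ^ n * t)) = enat n \<longleftrightarrow> chi_ord x = enat n"
  using assms
proof (induction n arbitrary: x t)
  case 0
  show ?case by (simp add: chi_ord_eq_0_iff)
next
  case (Suc n)
  define k where "k = int M ^ Suc n * t"
  obtain z where z: "of_nat M * x = of_int z" using Suc.prems by (elim Ints_cases)
  have "of_nat M * chi x = of_int (z * \<lceil>x\<rceil>)" by (simp add: chi_def z flip: mult.assoc)
  then have chi_Ints: "of_nat M * chi x \<in> \<int>" by simp
  have "of_int k * (x + of_int (\<lceil>x\<rceil> + k)) =
      of_int (int M ^ n * t) * (of_nat M * x + of_nat M * of_int (\<lceil>x\<rceil> + k))"
    by (simp add: k_def algebra_simps)
  also have "\<dots> = of_int (int M ^ n * (t * (z + int M * (\<lceil>x\<rceil> + k))))"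
    by (simp add: z)
  finally have chi_eq:
    "chi (x + of_int k) = chi x + of_int (int M ^ n * (t * (z + int M * (\<lceil>x\<rceil> + k))))"
    by (simp only: chi_add_of_int)
  show ?case
    unfolding k_def[symmetric] chi_ord_eq_Suc_iff chi_eq Suc.IH[OF chi_Ints] by simp
qed

lemma periodic_ord_set: "periodic (M ^ (n + 1)) (ord_set n M)"
  unfolding periodic_def
proof (intro allI impI)
  fix a b assume cong: "[a = b] (mod int (M ^ (n + 1)))"
  show "a \<in> ord_set n M \<longleftrightarrow> b \<in> ord_set n M"
  proof (cases "M = 0")
    case False
    obtain t where "a = b + int (M ^ (n + 1)) * t"
      using cong by (metis cong_iff_lin cong_sym)
    then have "of_int a / of_nat M = (of_int b / of_nat M + of_int (int M ^ n * t) :: rat)"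
      using False by (simp add: field_simps)
    then have "chi_ord (of_int a / of_nat M) = enat n \<longleftrightarrow> chi_ord (of_int b / of_nat M) = enat n"
      using chi_ord_add_of_int_eq_enat_iff[of M "of_int b / of_nat M"] False by simp
    moreover have "[a = b] (mod int M)" using cong by (rule cong_dvd_modulus) simp
    then have "coprime a (int M) \<longleftrightarrow> coprime b (int M)" using cong_imp_coprime cong_sym by blast
    ultimately show ?thesis by (simp add: ord_set_def)
  qed (use cong in simp)
qed

lemma class_count_eq_residue_count:
  assumes "M > 0"
  shows "class_count n M = residue_count (M ^ (n + 1)) (ord_set n M)"
  unfolding class_count_def
  using assms by (intro card_cong_classes_subset[OF periodic_ord_set]) simp

lemma coprime_fraction_not_Ints:
  assumes "coprime a (int M)" "M > 1"
  shows "(of_int a / of_nat M :: rat) \<notin> \<int>"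
proof -
  have "\<not> int M dvd a" using assms by (auto dest: coprime_common_divisor[of _ _ "int M"])
  then show ?thesis
    using of_int_div_of_int_in_Ints_iff[of a "int M", where ?'a = rat] assms(2) by simp
qed

lemma class_count_0:
  assumes "M > 1"
  shows "class_count 0 M = 0"
proof -
  have "ord_set 0 M = {}"
    using coprime_fraction_not_Ints assms by (auto simp: ord_set_def chi_ord_eq_0_iff)
  then show ?thesis using assms by (simp add: class_count_eq_residue_count)
qed

lemma class_count_1: "class_count n 1 = of_bool (n = 0)"
proof -
  have "chi_ord (of_int a) = 0" for a by (subst chi_ord_rec) simp
  then have "ord_set n 1 = (if n = 0 then UNIV else {})"
    by (auto simp: ord_set_def zero_enat_def)
  then show ?thesis by (simp add: class_count_eq_residue_count residue_count_def)
qed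

lemma chi_minus_divide:
  "chi (- (of_int b / of_nat M)) = of_int (b * (b div int M)) / of_nat M"
  using floor_divide_of_int_eq[of b "int M", where ?'a = rat] by (simp add: chi_def ceiling_minus)

lemma ord_set_Suc_iff:
  assumes M: "M = g * d" "M > 1" and s: "s < M" and e: "coprime e (int d)"
  shows "- (int g * e * int M + int s) \<in> ord_set (Suc n) M \<longleftrightarrow>
    coprime s M \<and> e * (int g * e * int M + int s) \<in> ord_set n d"
proof -
  define b where "b = int g * e * int M + int s"
  have "coprime b (int M) \<longleftrightarrow> coprime (int s) (int M)"
    by (simp only: b_def coprime_iff_gcd_eq_1 gcd.commute[of _ "int M"] gcd_add_mult)
  then have coprime_b: "coprime (- b) (int M) \<longleftrightarrow> coprime s M" by simp
  have "b div int M = int g * e" using s M(2) by (simp add: b_def)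
  then have "chi (of_int (- b) / of_nat M) = of_int (int g * (e * b)) / of_nat (g * d)"
    using chi_minus_divide[of b M] by (simp add: M(1) mult_ac)
  also have "\<dots> = of_int (e * b) / of_nat d" using M by auto
  finally have "chi_ord (of_int (- b) / of_nat M) = enat (Suc n) \<longleftrightarrow>
      chi_ord (of_int (e * b) / of_nat d) = enat n" if "coprime s M"
    using that coprime_b coprime_fraction_not_Ints[OF _ M(2)]
    by (simp only: chi_ord_eq_Suc_iff) simp
  moreover have "coprime (e * b) (int d)" if "coprime s M"
    using that coprime_b e M(1) by simp
  ultimately show ?thesis
    using coprime_b unfolding ord_set_def b_def[symmetric] by blast
qed

section \<open>The recurrence\<close>

lemma cong_quadratic_iff:
  fixes k s :: int
  assumes "d dvd k" "coprime s d"
  shows "[x * (k * x + s) = y * (k * y + s)] (mod d ^ j) \<longleftrightarrow> [x = y] (mod d ^ j)"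
proof -
  have "[s = k * (x + y) + s] (mod d)"
    using assms(1) by (simp add: cong_iff_dvd_diff)
  then have "coprime (k * (x + y) + s) (d ^ j)"
    using assms(2) cong_imp_coprime by auto
  moreover have "x * (k * x + s) - y * (k * y + s) = (x - y) * (k * (x + y) + s)"
    by (simp add: algebra_simps)
  ultimately show ?thesis
    by (simp add: cong_iff_dvd_diff coprime_dvd_mult_left_iff coprime_commute)
qed

lemma residue_count_quadratic:
  assumes "periodic (d ^ j) S" "int d dvd k" "coprime s (int d)"
  shows "residue_count (t * d ^ j) {e. e * (k * e + s) \<in> S} = t * residue_count (d ^ j) S"
proof -
  define f where "f e = e * (k * e + s)" for e
  have f_cong_iff: "[f x = f y] (mod int (d ^ j)) \<longleftrightarrow> [x = y] (mod int (d ^ j))" for x y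
    unfolding f_def of_nat_power using assms(2,3) by (rule cong_quadratic_iff)
  have "residue_count (t * d ^ j) (f -` S) = t * residue_count (d ^ j) (f -` S)"
    using assms(1) f_cong_iff by (intro residue_count_mult periodic_vimage) simp_all
  also have "\<dots> = t * residue_count (d ^ j) S"
    using assms(1) f_cong_iff by (simp add: residue_count_vimage)
  finally show ?thesis by (simp add: f_def vimage_def)
qed

lemma residue_count_ord_set_Suc_fibre:
  assumes M: "M = g * d" "M > 1" and s: "s < M"
  shows "residue_count (d * M ^ n)
      {e. coprime e (int d) \<and> - (int g * e * int M + int s) \<in> ord_set (Suc n) M} =
    of_bool (coprime s M) * (g ^ n * class_count n d)"
proof -
  have fibre: "{e. coprime e (int d) \<and> - (int g * e * int M + int s) \<in> ord_set (Suc n) M} =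
      {e. coprime s M \<and> e * (int g * e * int M + int s) \<in> ord_set n d}"
    using ord_set_Suc_iff[OF M s, where n = n] by (auto simp: ord_set_def)
  show ?thesis
  proof (cases "coprime s M")
    case True
    have "residue_count (g ^ n * d ^ (n + 1))
        {e. e * (int g * int M * e + int s) \<in> ord_set n d} = g ^ n * class_count n d"
      using M True residue_count_quadratic[OF periodic_ord_set]
      by (subst class_count_eq_residue_count) (auto intro: gr0I)
    moreover have "d * M ^ n = g ^ n * d ^ (n + 1)" by (simp add: M(1) power_mult_distrib)
    moreover have "int g * e * int M = int g * int M * e" for e by simp
    ultimately show ?thesis unfolding fibre using True by (simp only: simp_thms of_bool_eq mult_1)
  qed (simp add: fibre del: minus_add_distrib)
qed

lemma class_count_Suc:
  assumes "M > 1"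
  shows "class_count (Suc n) M = totient M * (\<Sum>d | d dvd M. (M div d) ^ n * class_count n d)"
proof -
  have "class_count (Suc n) M = residue_count (M * M ^ n * M) (ord_set (Suc n) M)"
    using assms by (simp add: class_count_eq_residue_count mult_ac)
  also have "\<dots> = residue_count (M * M ^ n * M) (uminus -` ord_set (Suc n) M)"
    using periodic_ord_set[of M "Suc n"]
    by (intro residue_count_vimage[symmetric]) (simp_all add: mult_ac cong_minus_minus_iff)
  also have "\<dots> = (\<Sum>s<M. residue_count (M * M ^ n)
      {q. - (q * int M + int s) \<in> ord_set (Suc n) M})"
    by (simp add: residue_count_split_mod)
  also have "\<dots> = (\<Sum>s<M. \<Sum>d | d dvd M. residue_count (d * M ^ n) {e. coprime e (int d) \<and>
      - (int (M div d) * e * int M + int s) \<in> ord_set (Suc n) M})"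
    using assms by (simp add: residue_count_split_gcd)
  also have "\<dots> = (\<Sum>s<M. of_bool (coprime s M)) *
      (\<Sum>d | d dvd M. (M div d) ^ n * class_count n d)"
    unfolding sum_product using assms
    by (intro sum.cong refl residue_count_ord_set_Suc_fibre) auto
  also have "(\<Sum>s<M. of_bool (coprime s M)) = totient M"
    using residue_count_coprime[of M] by (simp add: residue_count_eq_sum)
  finally show ?thesis .
qed

definition ord_prob :: "nat \<Rightarrow> nat \<Rightarrow> real" where
  "ord_prob n M = real (class_count n M) / real (totient (M ^ (n + 1)))"

lemma ord_prob_eq: "ord_prob n M = real (class_count n M) / (real M ^ n * real (totient M))"
  by (simp add: ord_prob_def totient_power_Suc del: power_Suc)

lemma ord_prob_Suc:
  assumes "M > 1"
  shows "ord_prob (Suc n) M = (\<Sum>d | d dvd M. real (totient d) / real M * ord_prob n d)"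
proof -
  have "ord_prob (Suc n) M =
      (\<Sum>d | d dvd M. real ((M div d) ^ n * class_count n d)) / real M ^ Suc n"
    using assms by (simp add: ord_prob_eq class_count_Suc)
  also have "\<dots> = (\<Sum>d | d dvd M. real (totient d) / real M * ord_prob n d)"
    unfolding sum_divide_distrib
  proof (intro sum.cong refl)
    fix d assume "d \<in> {d. d dvd M}"
    then obtain g where g: "M = d * g" by auto
    then have "d > 0" "g > 0" using assms by (auto intro: gr0I)
    then show "real ((M div d) ^ n * class_count n d) / real M ^ Suc n =
        real (totient d) / real M * ord_prob n d"
      by (simp add: ord_prob_eq g field_simps)
  qed
  finally show ?thesis .
qed

section \<open>Absorption\<close>

lemma sums_affine_recurrence:
  fixes p t :: "nat \<Rightarrow> real"
  assumes nonneg: "\<And>n. p n \<ge> 0" and "q < 1" and t: "t sums T"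
    and rec: "\<And>n. p (Suc n) = q * p n + t n"
  shows "p sums ((p 0 + T) / (1 - q))"
proof -
  have "Bseq (\<lambda>n. \<Sum>i<n. t i)"
    using t unfolding sums_def by (intro convergent_imp_Bseq convergentI)
  then obtain B where B: "\<And>n. \<bar>\<Sum>i<n. t i\<bar> \<le> B" by (auto simp: Bseq_def)
  have "(\<Sum>i<n. p i) \<le> (p 0 + B) / (1 - q)" for n
  proof -
    have "(\<Sum>i<n. p i) \<le> (\<Sum>i<Suc n. p i)" using nonneg by simp
    also have "\<dots> = p 0 + q * (\<Sum>i<n. p i) + (\<Sum>i<n. t i)"
      unfolding sum.lessThan_Suc_shift by (simp add: rec sum.distrib sum_distrib_left)
    finally have "(1 - q) * (\<Sum>i<n. p i) \<le> p 0 + B" using B[of n] by (simp add: algebra_simps)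
    then show ?thesis using \<open>q < 1\<close> by (simp add: field_simps)
  qed
  then have "summable p" using nonneg by (intro summableI_nonneg_bounded)
  then obtain L where L: "p sums L" by (auto simp: summable_def)
  then have "(\<lambda>n. p (Suc n)) sums (L - p 0)" by (simp add: sums_Suc_iff)
  moreover have "(\<lambda>n. p (Suc n)) sums (q * L + T)"
    unfolding rec by (intro sums_add sums_mult L t)
  ultimately have "L - p 0 = q * L + T" by (rule sums_unique2)
  then have "L = (p 0 + T) / (1 - q)" using \<open>q < 1\<close> by (simp add: field_simps)
  then show ?thesis using L by simp
qed

lemma ord_prob_1_sums: "(\<lambda>n. ord_prob n 1) sums 1"
proof -
  have "ord_prob n 1 = (if n = 0 then 1 else 0)" for n
    by (simp only: ord_prob_def class_count_1) simp
  then show ?thesis using sums_single[of 0 "\<lambda>_. 1 :: real"] by simp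
qed

lemma ord_prob_sums_one_of_divisors:
  assumes "M > 1" and divisors: "\<And>d. d dvd M \<Longrightarrow> d < M \<Longrightarrow> (\<lambda>n. ord_prob n d) sums 1"
  shows "(\<lambda>n. ord_prob n M) sums 1"
proof -
  define D where "D = {d. d dvd M \<and> d < M}"
  define q where "q = real (totient M) / real M"
  define t where "t n = (\<Sum>d\<in>D. real (totient d) / real M * ord_prob n d)" for n
  have D: "{d. d dvd M} = insert M D" "finite D" "M \<notin> D"
    using assms(1) by (auto simp: D_def dest: dvd_imp_le)
  have "(\<Sum>d | d dvd M. real (totient d)) = real M"
    using totient_divisor_sum[of M] by (metis of_nat_sum)
  then have "(\<Sum>d\<in>D. real (totient d) / real M * 1) = 1 - q"
    using assms(1) D by (simp add: q_def field_simps flip: sum_divide_distrib)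
  moreover have "t sums (\<Sum>d\<in>D. real (totient d) / real M * 1)"
    unfolding t_def by (intro sums_sum sums_mult divisors) (auto simp: D_def)
  ultimately have "t sums (1 - q)" by simp
  moreover have "ord_prob (Suc n) M = q * ord_prob n M + t n" for n
    using assms(1) D by (simp add: ord_prob_Suc q_def t_def)
  moreover have "q < 1" using totient_less[OF assms(1)] by (simp add: q_def)
  moreover have "ord_prob n M \<ge> 0" for n by (simp add: ord_prob_def)
  ultimately have "(\<lambda>n. ord_prob n M) sums ((ord_prob 0 M + (1 - q)) / (1 - q))"
    by (intro sums_affine_recurrence)
  moreover have "ord_prob 0 M = 0" using assms(1) by (simp add: ord_prob_def class_count_0)
  ultimately show ?thesis using \<open>q < 1\<close> by simp
qed

theorem theorem3p1:
  fixes M :: nat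
  assumes "M \<ge> 1"
  shows "(\<lambda>n. real (class_count n M) / real (totient (M ^ (n + 1)))) sums 1"
  unfolding ord_prob_def[symmetric] using assms
proof (induction M rule: less_induct)
  case (less M)
  show ?case
  proof (cases "M = 1")
    case True
    then show ?thesis using ord_prob_1_sums by simp
  next
    case False
    then have "M > 1" using less.prems by simp
    then show ?thesis
    proof (rule ord_prob_sums_one_of_divisors)
      fix d assume "d dvd M" "d < M"
      then have "d \<ge> 1" using less.prems by (auto intro: Suc_leI gr0I)
      then show "(\<lambda>n. ord_prob n d) sums 1" using less.IH \<open>d < M\<close> by blast
    qed
  qed
qed

end
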